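(* Let $R$ be a valuative semifield. If $I,J\subseteq R[x_0,\dots,x_n]$ are homogeneous tropical ideals with $I\subseteq J$ and identical Hilbert functions, then $I=J$. Thus there is no infinite ascending chain $I_1\subsetneq I_2\subsetneq I_3\subsetneq\cdots$ of tropical ideals in $R[x_0,\dots,x_n]$.
   Context: Valuative semifield: a semifield $(R,\oplus,\odot)$ with additive identity denoted $\infty$, such that $R^*=R\setminus\{\infty\}$ is a totally ordered group under $\odot$ and $a\oplus b=\min(a,b)$, where the order is extended to $R$ by making $\infty$ the largest element. $R[x_0,\dots,x_n]$ is the semiring of formal polynomials. An ideal of a semiring is a nonempty subset closed under addition and under multiplication by elements of the semiring. Valuated matroids: a valuated matroid of rank $r$ on a finite set $E$ with values in $R$ is $\mathcal M=(E,p)$ with $p:\binom{E}{r}\to R$ not identically $\infty$, such that for all $A,B\in\binom Er$ and $a\in A\setminus B$ there is $b\in B\setminus A$ with $p(A)\odot p(B)\ge p(A\cup b-a)\odot p(B\cup a-b)$; $p$ and $\lambda\odot p$ ($\lambda\in R^*$) define the same valuated matroid. The sets $B$ with $p(B)\ne\infty$ are the bases of the underlying matroid $\underline{\mathcal M}$. For a basis $B$ of $\underline{\mathcal M}$ and $e\in E\setminus B$, the fundamental circuit $H(B,e)\in R^E$ has coordinates $H(B,e)_{e'}=p(B\cup e-e')/p(B)$ (with $p$ of a set of size $>r$ taken to be $\infty$). Circuits are the vectors $\lambda\odot H(B,e)$ with $\lambda\in R^*$. The set of vectors $\mathcal V(\mathcal M)$ is the $R$-subsemimodule of $R^E$ generated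 by the circuits. Tropical ideals: an ideal $I\subseteq R[x_0,\dots,x_n]$ (not necessarily homogeneous) is a tropical ideal if for each $d\ge0$ the set $I_{\le d}$ of polynomials in $I$ of degree at most $d$ is the set of vectors of a valuated matroid on the set of monomials of degree at most $d$ (identifying a polynomial with its vector of coefficients). Homogeneous tropical ideals: let $\mathrm{Mon}_d$ be the set of monomials of degree $d$ in $x_0,\dots,x_n$, and identify $R^{\mathrm{Mon}_d}$ with the homogeneous polynomials of degree $d$. A homogeneous ideal $I\subseteq R[x_0,\dots,x_n]$ is a homogeneous tropical ideal if for each $d\ge0$ its degree-$d$ part $I_d$ equals $\mathcal V(\mathcal M_d(I))$ for a valuated matroid $\mathcal M_d(I)$ on $\mathrm{Mon}_d$. Hilbert function of a homogeneous tropical ideal $I$: $H_I(d)=\mathrm{rank}(\mathcal M_d(I))$ for $d\in\mathbb Z_{\ge0}$. *)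

theory Defs
  imports Complex_Main "HOL-Library.Poly_Mapping"
begin

text \<open>
  In a valuative semifield the additive identity \<open>0\<close> is the element \<open>\<infinity>\<close> of the min-plus convention,
  so it is the \<^emph>\<open>largest\<close> element, and \<open>1\<close> is the neutral element of the ordered group of elements
  \<open>\<noteq> 0\<close>.  Since \<open>+\<close> is \<open>min\<close>, distributivity is exactly compatibility of the order with
  multiplication.  No value is prescribed for \<open>inverse 0\<close>.
\<close>

class valuative_semifield = comm_semiring_1 + linorder + inverse +
  assumes add_eq_min: "a + b = min a b"
    and le_zero: "a \<le> 0"
    and inverse_left: "a \<noteq> 0 \<Longrightarrow> inverse a * a = 1"
    and divide_eq_times_inverse: "a / b = a * inverse b"

text \<open>
  The variables are indexed by a finite type \<open>'v\<close>; for \<open>x\<^sub>0, \<dots>, x\<^sub>n\<close> it has \<open>n + 1\<close> elements.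
  The product of formal polynomials is the convolution product of \<open>HOL-Library.Poly_Mapping\<close>.
\<close>

type_synonym 'v monomial = "'v \<Rightarrow>\<^sub>0 nat"
type_synonym ('v, 'r) polynomial = "'v monomial \<Rightarrow>\<^sub>0 'r"

definition mon_degree :: "'v::finite monomial \<Rightarrow> nat" where
  "mon_degree m = (\<Sum>i\<in>UNIV. Poly_Mapping.lookup m i)"

definition Mon :: "nat \<Rightarrow> 'v::finite monomial set" where
  "Mon d = {m. mon_degree m = d}"

definition Mon_le :: "nat \<Rightarrow> 'v::finite monomial set" where
  "Mon_le d = {m. mon_degree m \<le> d}"

definition semiring_ideal :: "'a::comm_semiring_1 set \<Rightarrow> bool" where
  "semiring_ideal I \<longleftrightarrow>
     I \<noteq> {} \<and> (\<forall>f\<in>I. \<forall>g\<in>I. f + g \<in> I) \<and> (\<forall>f\<in>I. \<forall>h. h * f \<in> I)"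

text \<open>
  A function \<open>p\<close> on the \<open>r\<close>-element subsets of \<open>E\<close> is encoded as a function on all sets that takes
  the value \<open>0 = \<infinity>\<close> elsewhere, and a vector in \<open>R\<^sup>E\<close> as a function on the whole type that is
  \<open>0 = \<infinity>\<close> outside \<open>E\<close>.  Valuated matroids are not identified up to scaling of \<open>p\<close>, which
  changes neither the circuits nor the vectors.
\<close>

definition valuated_matroid ::
    "'e set \<Rightarrow> nat \<Rightarrow> ('e set \<Rightarrow> 'r::valuative_semifield) \<Rightarrow> bool" where
  "valuated_matroid E r p \<longleftrightarrow>
     finite E \<and>
     (\<forall>A. \<not> (A \<subseteq> E \<and> card A = r) \<longrightarrow> p A = 0) \<and>
     (\<exists>A. A \<subseteq> E \<and> card A = r \<and> p A \<noteq> 0) \<and>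
     (\<forall>A B. A \<subseteq> E \<and> card A = r \<and> B \<subseteq> E \<and> card B = r \<longrightarrow>
        (\<forall>a\<in>A - B. \<exists>b\<in>B - A.
           p A * p B \<ge> p ((A \<union> {b}) - {a}) * p ((B \<union> {a}) - {b})))"

definition is_basis :: "('e set \<Rightarrow> 'r::valuative_semifield) \<Rightarrow> 'e set \<Rightarrow> bool" where
  "is_basis p B \<longleftrightarrow> p B \<noteq> 0"

text \<open>
  For \<open>x \<notin> B \<union> {e}\<close> the set \<open>B \<union> {e} - {x}\<close> has \<open>r + 1\<close> elements, so the coordinate is \<open>0\<close>.
\<close>

definition fundamental_circuit ::
    "('e set \<Rightarrow> 'r::valuative_semifield) \<Rightarrow> 'e set \<Rightarrow> 'e \<Rightarrow> 'e \<Rightarrow> 'r" where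
  "fundamental_circuit p B e = (\<lambda>x. p ((B \<union> {e}) - {x}) / p B)"

definition circuits ::
    "'e set \<Rightarrow> ('e set \<Rightarrow> 'r::valuative_semifield) \<Rightarrow> ('e \<Rightarrow> 'r) set" where
  "circuits E p =
     {\<lambda>x. c * fundamental_circuit p B e x | c B e. c \<noteq> 0 \<and> is_basis p B \<and> e \<in> E - B}"

definition subsemimodule :: "('e \<Rightarrow> 'r::comm_semiring_1) set \<Rightarrow> bool" where
  "subsemimodule V \<longleftrightarrow>
     (\<lambda>x. 0) \<in> V \<and>
     (\<forall>v\<in>V. \<forall>w\<in>V. (\<lambda>x. v x + w x) \<in> V) \<and>
     (\<forall>c. \<forall>v\<in>V. (\<lambda>x. c * v x) \<in> V)"

definition vectors ::
    "'e set \<Rightarrow> ('e set \<Rightarrow> 'r::valuative_semifield) \<Rightarrow> ('e \<Rightarrow> 'r) set" where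
  "vectors E p = subsemimodule hull circuits E p"

text \<open>The zero polynomial belongs to every \<open>degree_part I d\<close> and \<open>degree_le_part I d\<close>.\<close>

definition degree_part ::
    "('v::finite, 'r::comm_semiring_1) polynomial set \<Rightarrow> nat \<Rightarrow> ('v, 'r) polynomial set" where
  "degree_part I d = {f \<in> I. Poly_Mapping.keys f \<subseteq> Mon d}"

definition degree_le_part ::
    "('v::finite, 'r::comm_semiring_1) polynomial set \<Rightarrow> nat \<Rightarrow> ('v, 'r) polynomial set" where
  "degree_le_part I d = {f \<in> I. Poly_Mapping.keys f \<subseteq> Mon_le d}"

definition homogeneous_component ::
    "nat \<Rightarrow> ('v::finite, 'r::comm_semiring_1) polynomial \<Rightarrow> ('v, 'r) polynomial" where
  "homogeneous_component d f =
     (\<Sum>m \<in> Poly_Mapping.keys f \<inter> Mon d. Poly_Mapping.single m (Poly_Mapping.lookup f m))"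

definition homogeneous_ideal :: "('v::finite, 'r::comm_semiring_1) polynomial set \<Rightarrow> bool" where
  "homogeneous_ideal I \<longleftrightarrow>
     semiring_ideal I \<and> (\<forall>f\<in>I. \<forall>d. homogeneous_component d f \<in> I)"

definition tropical_ideal :: "('v::finite, 'r::valuative_semifield) polynomial set \<Rightarrow> bool" where
  "tropical_ideal I \<longleftrightarrow>
     semiring_ideal I \<and>
     (\<forall>d. \<exists>r p. valuated_matroid (Mon_le d) r p \<and>
        Poly_Mapping.lookup ` degree_le_part I d = vectors (Mon_le d) p)"

definition homogeneous_tropical_ideal ::
    "('v::finite, 'r::valuative_semifield) polynomial set \<Rightarrow> bool" where
  "homogeneous_tropical_ideal I \<longleftrightarrow>
     homogeneous_ideal I \<and>
     (\<forall>d. \<exists>r p. valuated_matroid (Mon d) r p \<and>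
        Poly_Mapping.lookup ` degree_part I d = vectors (Mon d) p)"

text \<open>
  The rank \<open>r\<close> is unique: the supports of the vectors determine the circuits, hence the bases, of
  the underlying matroid.
\<close>

definition hilbert_function ::
    "('v::finite, 'r::valuative_semifield) polynomial set \<Rightarrow> nat \<Rightarrow> nat" where
  "hilbert_function I d =
     (THE r. \<exists>p. valuated_matroid (Mon d) r p \<and>
        Poly_Mapping.lookup ` degree_part I d = vectors (Mon d) p)"

end

theory Submission
  imports Defs "HOL-Computational_Algebra.Primes"
begin

text \<open>
  Vectors of a valuated matroid are tropically orthogonal to its cocircuits, so a vector supported
  in \<open>B \<union> {e}\<close>, for a basis \<open>B\<close>, is a multiple of the fundamental circuit of \<open>(B, e)\<close>.  If the vectors
  of one valuated matroid are vectors of another one of the same rank, then every basis of the second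
  is a basis of the first, with the same fundamental circuits, and so the vectors coincide.

  For an ascending chain, fix a monomial order.  In \<open>I\<^bsub>\<le>d\<^esub>\<close> the monomials that are not initial
  form a basis, so the initial monomials determine the rank.  The pairs \<open>(d, m)\<close> with \<open>m\<close> initial in
  \<open>I\<^bsub>\<le>d\<^esub>\<close> form a set that is upward closed in the coordinates \<open>(d - deg m, m)\<close> and grows with \<open>I\<close>.
  By Dickson's lemma it takes the same value at two consecutive members of the chain; these then have
  the same ranks in all degrees and are equal.
\<close>

section \<open>Valuative semifields\<close>

lemma vsf_inverse_nonzero:
  fixes a :: "'r::valuative_semifield"
  assumes "a \<noteq> 0" shows "inverse a \<noteq> 0"
  using inverse_left[OF assms] by auto

lemma vsf_mult_left_cancel:
  fixes a :: "'r::valuative_semifield"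
  assumes "a \<noteq> 0" shows "inverse a * (a * b) = b"
  using inverse_left[OF assms] by (metis mult.assoc mult_1)

lemma vsf_mult_eq_0_iff:
  fixes a b :: "'r::valuative_semifield"
  shows "a * b = 0 \<longleftrightarrow> a = 0 \<or> b = 0"
  using vsf_mult_left_cancel[of a b] by (metis mult_zero_left mult_zero_right)

lemma vsf_divide_eq_0_iff:
  fixes a b :: "'r::valuative_semifield"
  assumes "b \<noteq> 0" shows "a / b = 0 \<longleftrightarrow> a = 0"
  using vsf_inverse_nonzero[OF assms] by (simp add: divide_eq_times_inverse vsf_mult_eq_0_iff)

lemma vsf_zero_le_iff:
  fixes a :: "'r::valuative_semifield"
  shows "0 \<le> a \<longleftrightarrow> a = 0"
  using le_zero[of a] by auto

text \<open>Since \<open>a \<le> b\<close> means \<open>a = a + b\<close>, monotonicity is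
  distributivity read through \<open>min\<close>.\<close>

lemma vsf_mult_left_mono:
  fixes a b c :: "'r::valuative_semifield"
  assumes "a \<le> b" shows "c * a \<le> c * b"
proof -
  have "c * a = c * (a + b)" using assms by (simp add: add_eq_min min_def)
  also have "\<dots> = min (c * a) (c * b)" by (simp only: distrib_left) (simp only: add_eq_min)
  finally show ?thesis by (metis min.cobounded2)
qed

section \<open>Vectors of a valuated matroid\<close>

lemma subsemimodule_vectors: "subsemimodule (vectors E p)"
  unfolding vectors_def by (rule hull_in) (auto simp: subsemimodule_def)

lemma circuits_subset_vectors: "circuits E p \<subseteq> vectors E p"
  unfolding vectors_def by (rule hull_subset)

lemma vectors_least:
  assumes "circuits E p \<subseteq> V" "subsemimodule V" shows "vectors E p \<subseteq> V"
  unfolding vectors_def using assms by (rule hull_minimal)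

lemma fundamental_circuit_in_vectors:
  fixes p :: "'e set \<Rightarrow> 'r::valuative_semifield"
  assumes "p B \<noteq> 0" "e \<in> E - B"
  shows "fundamental_circuit p B e \<in> vectors E p"
proof -
  have "fundamental_circuit p B e = (\<lambda>x. 1 * fundamental_circuit p B e x)" by simp
  moreover have "(1::'r) \<noteq> 0" by simp
  ultimately have "fundamental_circuit p B e \<in> circuits E p"
    unfolding circuits_def is_basis_def using assms by blast
  then show ?thesis using circuits_subset_vectors by blast
qed

lemma valuated_matroid_card:
  assumes "valuated_matroid E r p" "p A \<noteq> 0"
  shows "A \<subseteq> E" "card A = r" "finite A"
  using assms unfolding valuated_matroid_def by (auto dest: finite_subset)

lemma valuated_matroid_exchange:
  assumes "valuated_matroid E r p" "p A \<noteq> 0" "p B \<noteq> 0" "a \<in> A - B"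
  obtains b where "b \<in> B - A" "p ((A \<union> {b}) - {a}) * p ((B \<union> {a}) - {b}) \<le> p A * p B"
proof -
  have "A \<subseteq> E \<and> card A = r \<and> B \<subseteq> E \<and> card B = r"
    using valuated_matroid_card assms by metis
  then have "\<exists>b\<in>B - A. p ((A \<union> {b}) - {a}) * p ((B \<union> {a}) - {b}) \<le> p A * p B"
    using assms(1,4) unfolding valuated_matroid_def by blast
  then show thesis using that by blast
qed

text \<open>
  Tropical orthogonality to the cocircuits \<open>x \<mapsto> p (A \<union> {x})\<close>: a minimum of finite value is attained
  at least twice.
\<close>

definition orthogonal :: "('e set \<Rightarrow> 'r::valuative_semifield) \<Rightarrow> ('e \<Rightarrow> 'r) set" where
  "orthogonal p = {v. \<forall>A x. x \<notin> A \<longrightarrow> p (insert x A) * v x \<noteq> 0 \<longrightarrow>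
     (\<exists>y. y \<notin> A \<and> y \<noteq> x \<and> p (insert y A) * v y \<le> p (insert x A) * v x)}"

lemma orthogonalD:
  assumes "v \<in> orthogonal p" "x \<notin> A" "p (insert x A) * v x \<noteq> 0"
  obtains y where "y \<notin> A" "y \<noteq> x" "p (insert y A) * v y \<le> p (insert x A) * v x"
  using assms unfolding orthogonal_def by blast

text \<open>For a sum, let \<open>u\<close> be whichever of \<open>v\<close>, \<open>w\<close> is
  smaller at \<open>x\<close>. It agrees with the sum at \<open>x\<close> and lies above it
  everywhere, so a second position \<open>y\<close> found for \<open>u\<close> also serves the
  sum.\<close>

lemma subsemimodule_orthogonal: "subsemimodule (orthogonal p)"
proof -
  have add: "(\<lambda>x. v x + w x) \<in> orthogonal p"
    if v: "v \<in> orthogonal p" and w: "w \<in> orthogonal p" for v w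
    unfolding orthogonal_def
  proof (rule CollectI, intro allI impI)
    fix A x assume x: "x \<notin> A" and nz: "p (insert x A) * (v x + w x) \<noteq> 0"
    obtain u where u: "u \<in> orthogonal p" "v x + w x = u x" "\<And>y. v y + w y \<le> u y"
    proof (cases "v x \<le> w x")
      case True
      then show thesis using that[of v] v by (simp add: add_eq_min)
    next
      case False
      then show thesis using that[of w] w by (simp add: add_eq_min)
    qed
    obtain y where "y \<notin> A" "y \<noteq> x" "p (insert y A) * u y \<le> p (insert x A) * u x"
      using orthogonalD[OF u(1) x] nz u(2) by metis
    then show "\<exists>y. y \<notin> A \<and> y \<noteq> x \<and>
        p (insert y A) * (v y + w y) \<le> p (insert x A) * (v x + w x)"
      using u(2) vsf_mult_left_mono[OF u(3)] by (metis order_trans)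
  qed
  have scale: "(\<lambda>x. c * v x) \<in> orthogonal p" if v: "v \<in> orthogonal p" for c v
    unfolding orthogonal_def
  proof (rule CollectI, intro allI impI)
    fix A x assume x: "x \<notin> A" and nz: "p (insert x A) * (c * v x) \<noteq> 0"
    have "p (insert x A) * v x \<noteq> 0" using nz by (auto simp: vsf_mult_eq_0_iff)
    then obtain y where "y \<notin> A" "y \<noteq> x" "p (insert y A) * v y \<le> p (insert x A) * v x"
      using orthogonalD[OF v x] by metis
    then show "\<exists>y. y \<notin> A \<and> y \<noteq> x \<and>
        p (insert y A) * (c * v y) \<le> p (insert x A) * (c * v x)"
      using vsf_mult_left_mono by (metis mult.left_commute)
  qed
  have "(\<lambda>x. 0) \<in> orthogonal p" by (simp add: orthogonal_def)
  with add scale show ?thesis unfolding subsemimodule_def by blast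
qed

text \<open>The required inequality is the exchange axiom for the bases \<open>insert x A\<close>
  and \<open>?S - {x}\<close>, trading \<open>x\<close> for \<open>b\<close>, divided by
  \<open>p B\<close>.\<close>

lemma fundamental_circuit_orthogonal:
  assumes M: "valuated_matroid E r p" and B: "p B \<noteq> 0" and e: "e \<in> E - B"
  shows "fundamental_circuit p B e \<in> orthogonal p"
  unfolding orthogonal_def
proof (rule CollectI, intro allI impI)
  fix A x
  let ?S = "B \<union> {e}"
  assume x: "x \<notin> A" and nz: "p (insert x A) * fundamental_circuit p B e x \<noteq> 0"
  have A: "p (insert x A) \<noteq> 0" and S: "p (?S - {x}) \<noteq> 0"
    using nz B by (auto simp: fundamental_circuit_def vsf_mult_eq_0_iff vsf_divide_eq_0_iff)
  obtain b where b: "b \<in> (?S - {x}) - insert x A"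
    and le: "p ((insert x A \<union> {b}) - {x}) * p (((?S - {x}) \<union> {x}) - {b})
       \<le> p (insert x A) * p (?S - {x})"
    using valuated_matroid_exchange[OF M A S, of x] by auto
  \<comment> \<open>Otherwise the basis \<open>?S - {x}\<close> would be all of \<open>?S\<close>,
    which has one element too many. So putting \<open>x\<close> back restores
    \<open>?S\<close>.\<close>
  have "x \<in> ?S"
  proof (rule ccontr)
    assume "x \<notin> ?S"
    then have "card ?S = card B" using valuated_matroid_card[OF M] B S by simp
    then show False using e valuated_matroid_card(3)[OF M B] by auto
  qed
  then have "((?S - {x}) \<union> {x}) - {b} = ?S - {b}" by auto
  moreover have "(insert x A \<union> {b}) - {x} = insert b A" using b x by auto
  ultimately have "p (insert b A) * p (?S - {b}) \<le> p (insert x A) * p (?S - {x})"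
    using le by metis
  from vsf_mult_left_mono[OF this, of "inverse (p B)"]
  have "p (insert b A) * fundamental_circuit p B e b
      \<le> p (insert x A) * fundamental_circuit p B e x"
    unfolding fundamental_circuit_def divide_eq_times_inverse by (simp only: ac_simps)
  then show "\<exists>y. y \<notin> A \<and> y \<noteq> x \<and> p (insert y A) * fundamental_circuit p B e y
      \<le> p (insert x A) * fundamental_circuit p B e x"
    using b by blast
qed

section \<open>Orthogonality of vectors and exchange with bases\<close>

lemma vectors_subset_orthogonal:
  assumes "valuated_matroid E r p"
  shows "vectors E p \<subseteq> orthogonal p"
proof (rule vectors_least)
  show "circuits E p \<subseteq> orthogonal p"
    using subsemimodule_orthogonal[of p] fundamental_circuit_orthogonal[OF assms]
    unfolding circuits_def is_basis_def subsemimodule_def by blast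
qed (rule subsemimodule_orthogonal)

text \<open>Orthogonality is applied to the cocircuit of \<open>B - {x}\<close>, whose value at
  \<open>x\<close> is \<open>p B\<close>. The second position \<open>y\<close> lies outside
  \<open>B\<close>, and both factors there are finite because their product is bounded by a finite
  value.\<close>

lemma vector_exchange:
  assumes M: "valuated_matroid E r p" and v: "v \<in> vectors E p"
    and B: "p B \<noteq> 0" "x \<in> B" and x: "v x \<noteq> 0"
  obtains y where "y \<notin> B" "p (insert y (B - {x})) * v y \<le> p B * v x"
    "v y \<noteq> 0" "p (insert y (B - {x})) \<noteq> 0"
proof -
  have eq: "insert x (B - {x}) = B" using B by auto
  have nz: "p (insert x (B - {x})) * v x \<noteq> 0" using B x eq by (simp add: vsf_mult_eq_0_iff)
  obtain y where y: "y \<notin> B - {x}" "y \<noteq> x" "p (insert y (B - {x})) * v y \<le> p B * v x"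
    using orthogonalD[of v p x "B - {x}"] nz vectors_subset_orthogonal[OF M] v eq
    by (metis Diff_iff insertI1 subsetD)
  have "p (insert y (B - {x})) * v y \<noteq> 0"
    using y(3) nz eq by (metis vsf_zero_le_iff)
  then show thesis using that[of y] y by (auto simp: vsf_mult_eq_0_iff)
qed

text \<open>For \<open>x\<close> in \<open>B\<close>, the support of \<open>v\<close> meets the
  complement of \<open>B - {x}\<close> in at most \<open>x\<close> and \<open>e\<close>. Hence an
  exchange starting at one of them must land at the other, which gives the two inequalities behind
  \<open>p B * v x = p ?B * v e\<close>.\<close>

lemma vector_eq_multiple_fundamental_circuit:
  assumes M: "valuated_matroid E r p" and v: "v \<in> vectors E p"
    and B: "p B \<noteq> 0" and e: "e \<in> E - B" and supp: "\<And>x. v x \<noteq> 0 \<Longrightarrow> x \<in> insert e B"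
  shows "v x = v e * fundamental_circuit p B e x"
proof -
  consider "x = e" | "x \<in> B" | "x \<notin> insert e B" by blast
  then show ?thesis
  proof cases
    case 1
    then have "(B \<union> {e}) - {x} = B" using e by auto
    then have "fundamental_circuit p B e x = 1"
      using inverse_left[OF B] unfolding fundamental_circuit_def
      by (simp add: divide_eq_times_inverse mult.commute)
    then show ?thesis using 1 by simp
  next
    case 2
    let ?B = "insert e (B - {x})"
    have S: "(B \<union> {e}) - {x} = ?B" using 2 e by auto
    have eq: "p B * v x = p ?B * v e"
    proof (rule antisym)
      show "p ?B * v e \<le> p B * v x"
      proof (cases "v x = 0")
        case True
        then show ?thesis by (simp add: le_zero)
      next
        case False
        then obtain y where "y \<notin> B" "p (insert y (B - {x})) * v y \<le> p B * v x" "v y \<noteq> 0"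
          using vector_exchange[OF M v B 2] by metis
        then show ?thesis using supp[of y] by auto
      qed
      show "p B * v x \<le> p ?B * v e"
      proof (cases "p ?B * v e = 0")
        case True
        then show ?thesis by (simp add: le_zero)
      next
        case False
        then have nz: "p ?B \<noteq> 0" "v e \<noteq> 0" by (auto simp: vsf_mult_eq_0_iff)
        obtain y where y: "y \<notin> ?B" "p (insert y (?B - {e})) * v y \<le> p ?B * v e" "v y \<noteq> 0"
          using vector_exchange[OF M v nz(1) _ nz(2)] by blast
        then have "y = x" using supp[of y] by auto
        moreover have "insert x (?B - {e}) = B" using 2 e by auto
        ultimately show ?thesis using y(2) by simp
      qed
    qed
    have "v x = inverse (p B) * (p B * v x)" by (simp add: vsf_mult_left_cancel[OF B])
    also have "\<dots> = v e * fundamental_circuit p B e x"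
      unfolding eq fundamental_circuit_def S divide_eq_times_inverse by (simp only: ac_simps)
    finally show ?thesis .
  next
    case 3
    \<comment> \<open>Nothing is removed, so this set has \<open>r + 1\<close> elements and
      \<open>p\<close> is \<open>0\<close> on it.\<close>
    then have "(B \<union> {e}) - {x} = insert e B" by auto
    moreover have "p (insert e B) = 0"
      using valuated_matroid_card[OF M, of "insert e B"] valuated_matroid_card[OF M B] e by auto
    ultimately have "fundamental_circuit p B e x = 0"
      by (simp add: fundamental_circuit_def divide_eq_times_inverse)
    then show ?thesis using supp[of x] 3 by auto
  qed
qed

text \<open>If \<open>v x\<close> were nonzero, exchanging \<open>x\<close> would produce an element
  of the support outside \<open>B\<close>.\<close>

lemma vector_support_not_subset_basis:
  assumes "valuated_matroid E r p" "v \<in> vectors E p" "p B \<noteq> 0" "\<And>x. v x \<noteq> 0 \<Longrightarrow> x \<in> B"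
  shows "v x = 0"
  using vector_exchange[of E r p v B x] assms by blast

text \<open>Choose a basis \<open>A\<close> with \<open>B - A\<close> as small as possible. For
  \<open>e\<close> in \<open>B - A\<close>, the circuit of \<open>(A, e)\<close> is nonzero, so it
  has a support element \<open>y\<close> outside \<open>B\<close>; trading \<open>y\<close> for
  \<open>e\<close> gives a basis closer to \<open>B\<close>.\<close>

lemma independent_is_basis:
  assumes M: "valuated_matroid E r p" and B: "B \<subseteq> E" "card B = r"
    and ind: "\<And>v x. v \<in> vectors E p \<Longrightarrow> (\<And>x. v x \<noteq> 0 \<Longrightarrow> x \<in> B) \<Longrightarrow> v x = 0"
  shows "p B \<noteq> 0"
proof -
  have fB: "finite B" using M B unfolding valuated_matroid_def by (auto dest: finite_subset)
  obtain A0 where A0: "p A0 \<noteq> 0" using M unfolding valuated_matroid_def by auto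
  obtain A where A: "p A \<noteq> 0" and min: "\<And>A'. p A' \<noteq> 0 \<Longrightarrow> card (B - A) \<le> card (B - A')"
    using ex_has_least_nat[of "\<lambda>A. p A \<noteq> 0" A0 "\<lambda>A. card (B - A)"] A0 by blast
  note cA = valuated_matroid_card[OF M A]
  have "B \<subseteq> A"
  proof
    fix e assume e: "e \<in> B"
    show "e \<in> A"
    proof (rule ccontr)
      assume eA: "e \<notin> A"
      let ?v = "fundamental_circuit p A e"
      have E: "e \<in> E - A" using e eA B by auto
      have "(A \<union> {e}) - {e} = A" using eA by auto
      then have "?v e \<noteq> 0" using A by (simp add: fundamental_circuit_def vsf_divide_eq_0_iff)
      then obtain y where y: "?v y \<noteq> 0" "y \<notin> B"
        using ind[OF fundamental_circuit_in_vectors[of p A, OF A E]] by blast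
      then have "p ((A \<union> {e}) - {y}) \<noteq> 0"
        using A by (simp add: fundamental_circuit_def vsf_divide_eq_0_iff)
      from min[OF this] have "card (B - A) \<le> card (B - ((A \<union> {e}) - {y}))" .
      moreover have "B - ((A \<union> {e}) - {y}) \<subset> B - A" using y e eA by auto
      ultimately show False using psubset_card_mono[of "B - A"] fB by (metis finite_Diff leD)
    qed
  qed
  then have "B = A" using cA B by (simp add: card_subset_eq)
  then show ?thesis using A by simp
qed

text \<open>It suffices that each circuit of \<open>q\<close> is a vector of \<open>p\<close>, which
  follows by recognizing it as a multiple of a fundamental circuit of \<open>p\<close>.\<close>

lemma vectors_eq_of_subset_same_rank:
  assumes M: "valuated_matroid E r p" and N: "valuated_matroid E r q"
    and sub: "vectors E p \<subseteq> vectors E q"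
  shows "vectors E p = vectors E q"
proof
  have "circuits E q \<subseteq> vectors E p"
  proof
    fix u assume "u \<in> circuits E q"
    then obtain c B e where u: "u = (\<lambda>x. c * fundamental_circuit q B e x)"
      and B: "q B \<noteq> 0" and e: "e \<in> E - B"
      unfolding circuits_def is_basis_def by blast
    \<comment> \<open>\<open>B\<close> contains the support of no nonzero vector of
      \<open>q\<close>, hence of none of \<open>p\<close>; equality of the ranks gives it the
      cardinality of a basis of \<open>p\<close>.\<close>
    have "p B \<noteq> 0"
    proof (rule independent_is_basis[OF M])
      fix v x assume "v \<in> vectors E p" "\<And>x. v x \<noteq> 0 \<Longrightarrow> x \<in> B"
      then show "v x = 0" using vector_support_not_subset_basis[OF N _ B] sub by blast
    qed (use valuated_matroid_card[OF N B] in auto)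
    let ?v = "fundamental_circuit p B e"
    have v: "?v \<in> vectors E p" using \<open>p B \<noteq> 0\<close> e by (rule fundamental_circuit_in_vectors)
    have supp: "x \<in> insert e B" if "?v x \<noteq> 0" for x
    proof (rule ccontr)
      assume "x \<notin> insert e B"
      then have "p (insert e B) \<noteq> 0"
        using that \<open>p B \<noteq> 0\<close> by (auto simp: fundamental_circuit_def vsf_divide_eq_0_iff)
      then show False
        using valuated_matroid_card[OF M, of "insert e B"] valuated_matroid_card[OF M \<open>p B \<noteq> 0\<close>] e
        by auto
    qed
    have "(B \<union> {e}) - {e} = B" using e by auto
    then have one: "?v e = 1"
      using inverse_left[OF \<open>p B \<noteq> 0\<close>] unfolding fundamental_circuit_def
      by (simp add: divide_eq_times_inverse mult.commute)
    \<comment> \<open>As a vector of \<open>q\<close> supported in \<open>insert e B\<close>,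
      \<open>?v\<close> is a multiple of the circuit of \<open>q\<close>, with factor
      \<open>?v e = 1\<close>.\<close>
    have "?v x = fundamental_circuit q B e x" for x
      using vector_eq_multiple_fundamental_circuit[OF N subsetD[OF sub v] B e supp, of x]
      unfolding one mult_1 .
    then have "fundamental_circuit q B e = ?v" by (intro ext) (rule sym)
    moreover have "(\<lambda>x. c * ?v x) \<in> vectors E p"
      using v subsemimodule_vectors[of E p] unfolding subsemimodule_def by blast
    ultimately show "u \<in> vectors E p" unfolding u by (simp only:)
  qed
  then show "vectors E q \<subseteq> vectors E p"
    using subsemimodule_vectors by (rule vectors_least)
qed (rule sub)

section \<open>Initial elements\<close>

text \<open>For coefficient vectors of polynomials and a monomial order \<kappa>, these are the
  leading monomials.\<close>

definition initial :: "('e \<Rightarrow> nat) \<Rightarrow> ('e \<Rightarrow> 'r::zero) set \<Rightarrow> 'e set" where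
  "initial \<kappa> V = {e. \<exists>v\<in>V. v e \<noteq> 0 \<and> (\<forall>x. v x \<noteq> 0 \<longrightarrow> \<kappa> x \<le> \<kappa> e)}"

lemma initial_mono: "V \<subseteq> W \<Longrightarrow> initial \<kappa> V \<subseteq> initial \<kappa> W"
  unfolding initial_def by blast

lemma sum_exchange_less:
  fixes \<kappa> :: "'e \<Rightarrow> nat"
  assumes "finite B" "x \<in> B" "e \<notin> B" "\<kappa> e < \<kappa> x"
  shows "sum \<kappa> (insert e (B - {x})) < sum \<kappa> B"
  using assms by (simp add: sum.remove[of B x])

text \<open>The complement of the initial elements is the basis of minimal \<open>\<kappa>\<close>-weight.\<close>

lemma card_complement_initial:
  assumes M: "valuated_matroid E r p" and inj: "inj_on \<kappa> E"
  shows "card (E - initial \<kappa> (vectors E p)) = r"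
proof -
  obtain B0 where B0: "p B0 \<noteq> 0" using M unfolding valuated_matroid_def by auto
  obtain B where B: "p B \<noteq> 0" and min: "\<And>B'. p B' \<noteq> 0 \<Longrightarrow> sum \<kappa> B \<le> sum \<kappa> B'"
    using ex_has_least_nat[of "\<lambda>A. p A \<noteq> 0" B0 "sum \<kappa>"] B0 by blast
  note cB = valuated_matroid_card[OF M B]
  \<comment> \<open>Minimal weight means that an exchange never brings in a smaller element, and
    injectivity excludes equality.\<close>
  have no_exchange: "\<kappa> x < \<kappa> e" if "p (insert e (B - {x})) \<noteq> 0" "x \<in> B" "e \<notin> B" for e x
  proof -
    have "\<not> \<kappa> e < \<kappa> x" using min[OF that(1)] sum_exchange_less[OF cB(3) that(2,3), of \<kappa>] by auto
    moreover have "e \<in> E" using valuated_matroid_card(1)[OF M that(1)] by auto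
    then have "\<kappa> e \<noteq> \<kappa> x" using inj_onD[OF inj] that(2,3) cB(1) by blast
    ultimately show ?thesis by linarith
  qed
  \<comment> \<open>The fundamental circuit of \<open>(B, e)\<close> is the witness: any other
    support element can be exchanged for \<open>e\<close>, so its weight is smaller.\<close>
  have "e \<in> initial \<kappa> (vectors E p)" if e: "e \<in> E - B" for e
  proof -
    let ?v = "fundamental_circuit p B e"
    have "(B \<union> {e}) - {e} = B" using e by auto
    then have "?v e \<noteq> 0" using B by (simp add: fundamental_circuit_def vsf_divide_eq_0_iff)
    moreover have "\<kappa> x \<le> \<kappa> e" if "?v x \<noteq> 0" for x
    proof (cases "x \<in> B")
      case True
      then have "(B \<union> {e}) - {x} = insert e (B - {x})" using e by auto
      then have "p (insert e (B - {x})) \<noteq> 0"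
        using that B by (simp add: fundamental_circuit_def vsf_divide_eq_0_iff)
      then show ?thesis using no_exchange[of e x] True e by auto
    next
      case False
      have "p (insert e B - {x}) \<noteq> 0"
        using that B by (simp add: fundamental_circuit_def vsf_divide_eq_0_iff)
      then have "card (insert e B - {x}) = card B"
        using valuated_matroid_card[OF M] cB by simp
      then have "x = e" using False e cB(3) by (cases "x = e") auto
      then show ?thesis by simp
    qed
    ultimately show ?thesis
      using fundamental_circuit_in_vectors[of p B, OF B e] unfolding initial_def by blast
  qed
  \<comment> \<open>A vector led by \<open>e\<close> would allow exchanging \<open>e\<close> for
    some \<open>y\<close> of its support outside \<open>B\<close>; then \<kappa> is larger at
    \<open>y\<close> than at the leading element.\<close>
  moreover have "e \<notin> initial \<kappa> (vectors E p)" if e: "e \<in> B" for e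
  proof
    assume "e \<in> initial \<kappa> (vectors E p)"
    then obtain v where v: "v \<in> vectors E p" "v e \<noteq> 0" "\<And>x. v x \<noteq> 0 \<Longrightarrow> \<kappa> x \<le> \<kappa> e"
      unfolding initial_def by blast
    obtain y where "y \<notin> B" "v y \<noteq> 0" "p (insert y (B - {e})) \<noteq> 0"
      using vector_exchange[OF M v(1) B e v(2)] by blast
    then show False using no_exchange[of y e] e v(3)[of y] by auto
  qed
  ultimately have "E - initial \<kappa> (vectors E p) = B" using cB(1) by blast
  then show ?thesis using cB(2) by simp
qed

text \<open>The count of non-initial elements depends only on the set of vectors and on \<kappa>,
  and any injection of the finite set \<open>E\<close> into the naturals can serve as
  \<kappa>.\<close>

lemma rank_unique:
  assumes M: "valuated_matroid E r p" and N: "valuated_matroid E s q"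
    and eq: "vectors E p = vectors E q"
  shows "r = s"
proof -
  have "finite E" using M unfolding valuated_matroid_def by blast
  then obtain \<kappa> :: "'a \<Rightarrow> nat" where "inj_on \<kappa> E"
    using finite_imp_inj_to_nat_seg by blast
  then show ?thesis
    using card_complement_initial[OF M] card_complement_initial[OF N] eq by metis
qed

section \<open>Homogeneous tropical ideals\<close>

lemma hilbert_function_eq:
  assumes M: "valuated_matroid (Mon d) r p"
    and V: "Poly_Mapping.lookup ` degree_part I d = vectors (Mon d) p"
  shows "hilbert_function I d = r"
  unfolding hilbert_function_def
proof (rule the_equality)
  show "\<exists>p. valuated_matroid (Mon d) r p \<and> Poly_Mapping.lookup ` degree_part I d = vectors (Mon d) p"
    using M V by blast
next
  fix s assume "\<exists>q. valuated_matroid (Mon d) s q \<and>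
      Poly_Mapping.lookup ` degree_part I d = vectors (Mon d) q"
  then show "s = r" using rank_unique[OF _ M] V by metis
qed

lemma inj_lookup: "inj Poly_Mapping.lookup"
  by (rule injI) (simp add: poly_mapping_eqI)

lemma semiring_ideal_sum:
  assumes I: "semiring_ideal I" and f: "\<And>i. i \<in> S \<Longrightarrow> f i \<in> I"
  shows "sum f S \<in> I"
proof -
  obtain g where "g \<in> I" using I unfolding semiring_ideal_def by blast
  \<comment> \<open>The empty sum requires \<open>0\<close> to be in the ideal; it is obtained as a
    multiple of an arbitrary element.\<close>
  then have "0 * g \<in> I" using I unfolding semiring_ideal_def by blast
  then have zero: "0 \<in> I" by simp
  show ?thesis using f
  proof (induction S rule: infinite_finite_induct)
    case (insert x F)
    then show ?case using I unfolding semiring_ideal_def by simp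
  qed (use zero in auto)
qed

lemma lookup_homogeneous_component:
  "Poly_Mapping.lookup (homogeneous_component d f) m
     = (if mon_degree m = d then Poly_Mapping.lookup f m else 0)"
proof -
  have "Poly_Mapping.lookup (homogeneous_component d f) m
      = (\<Sum>k \<in> Poly_Mapping.keys f \<inter> Mon d. if k = m then Poly_Mapping.lookup f k else 0)"
    unfolding homogeneous_component_def
    by (simp add: lookup_sum lookup_single when_def)
  also have "\<dots> = (if m \<in> Poly_Mapping.keys f \<inter> Mon d then Poly_Mapping.lookup f m else 0)"
    by (simp add: sum.delta)
  also have "\<dots> = (if mon_degree m = d then Poly_Mapping.lookup f m else 0)"
    by (auto simp: Mon_def in_keys_iff)
  finally show ?thesis .
qed

lemma keys_homogeneous_component: "Poly_Mapping.keys (homogeneous_component d f) \<subseteq> Mon d"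
  by (auto simp: Mon_def in_keys_iff lookup_homogeneous_component split: if_splits)

lemma sum_homogeneous_components:
  "(\<Sum>d \<in> mon_degree ` Poly_Mapping.keys f. homogeneous_component d f) = f"
proof (rule poly_mapping_eqI)
  fix m
  have "Poly_Mapping.lookup (\<Sum>d \<in> mon_degree ` Poly_Mapping.keys f. homogeneous_component d f) m
      = (\<Sum>d \<in> mon_degree ` Poly_Mapping.keys f. if mon_degree m = d then Poly_Mapping.lookup f m else 0)"
    by (simp add: lookup_sum lookup_homogeneous_component)
  also have "\<dots> = Poly_Mapping.lookup f m"
    by (auto simp: sum.delta' in_keys_iff)
  finally show "Poly_Mapping.lookup (\<Sum>d \<in> mon_degree ` Poly_Mapping.keys f. homogeneous_component d f) m
      = Poly_Mapping.lookup f m" .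
qed

text \<open>The ranks agree in each degree, so the degree parts coincide. They determine the ideals,
  because a polynomial is the sum of its homogeneous components.\<close>

lemma homogeneous_tropical_ideal_eq:
  fixes I J :: "('v::finite, 'r::valuative_semifield) polynomial set"
  assumes I: "homogeneous_tropical_ideal I" and J: "homogeneous_tropical_ideal J" and sub: "I \<subseteq> J"
    and H: "\<And>d. hilbert_function I d = hilbert_function J d"
  shows "I = J"
proof
  have part: "degree_part I d = degree_part J d" for d
  proof -
    obtain r p where M: "valuated_matroid (Mon d) r p"
      and Ip: "Poly_Mapping.lookup ` degree_part I d = vectors (Mon d) p"
      using I unfolding homogeneous_tropical_ideal_def by blast
    obtain s q where N: "valuated_matroid (Mon d) s q"
      and Jq: "Poly_Mapping.lookup ` degree_part J d = vectors (Mon d) q"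
      using J unfolding homogeneous_tropical_ideal_def by blast
    have "r = s" using H hilbert_function_eq[OF M Ip] hilbert_function_eq[OF N Jq] by simp
    moreover have "degree_part I d \<subseteq> degree_part J d" using sub unfolding degree_part_def by blast
    then have "vectors (Mon d) p \<subseteq> vectors (Mon d) q" using Ip Jq by (metis image_mono)
    ultimately have "vectors (Mon d) p = vectors (Mon d) q"
      using M N vectors_eq_of_subset_same_rank by blast
    then show ?thesis using Ip Jq inj_lookup by (metis inj_image_eq_iff)
  qed
  show "J \<subseteq> I"
  proof
    fix f assume "f \<in> J"
    have "homogeneous_component d f \<in> I" for d
    proof -
      have "homogeneous_component d f \<in> degree_part J d"
        using J \<open>f \<in> J\<close> keys_homogeneous_component
        unfolding homogeneous_tropical_ideal_def homogeneous_ideal_def degree_part_def by blast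
      then show ?thesis using part[of d] unfolding degree_part_def by blast
    qed
    then have "(\<Sum>d \<in> mon_degree ` Poly_Mapping.keys f. homogeneous_component d f) \<in> I"
      using I unfolding homogeneous_tropical_ideal_def homogeneous_ideal_def
      by (blast intro: semiring_ideal_sum)
    then show "f \<in> I" by (simp add: sum_homogeneous_components)
  qed
qed (rule sub)

section \<open>Ascending chains\<close>

lemma nat_seq_mono_subseq:
  fixes s :: "nat \<Rightarrow> nat"
  shows "\<exists>g::nat \<Rightarrow> nat. strict_mono g \<and> mono (s \<circ> g)"
proof -
  obtain g :: "nat \<Rightarrow> nat" where g: "strict_mono g" "monoseq (\<lambda>n. s (g n))"
    using seq_monosub by blast
  from g(2) show ?thesis
    unfolding monoseq_iff
  proof
    assume "incseq (\<lambda>n. s (g n))"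
    then show ?thesis using g(1) by (auto simp: comp_def)
  next
    assume dec: "decseq (\<lambda>n. s (g n))"
    \<comment> \<open>A decreasing sequence of naturals is constant once it reaches its least value,
      so this tail is also increasing.\<close>
    obtain N where N: "\<And>n. s (g N) \<le> s (g n)"
      using ex_has_least_nat[of "\<lambda>_. True" 0 "\<lambda>n. s (g n)"] by blast
    then have "s (g (N + n)) = s (g N)" for n
      using dec by (simp add: antisym decseq_def)
    then have "mono (s \<circ> (\<lambda>n. g (N + n)))" by (simp add: mono_def)
    moreover have "strict_mono (\<lambda>n. g (N + n))" using g(1) by (simp add: strict_mono_def)
    ultimately show ?thesis by blast
  qed
qed

text \<open>The subsequence is refined one coordinate at a time; refinement preserves monotonicity
  of the coordinates already treated.\<close>

lemma dickson_subseq: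
  fixes s :: "nat \<Rightarrow> 'i \<Rightarrow> nat"
  assumes "finite S"
  shows "\<exists>g::nat \<Rightarrow> nat. strict_mono g \<and> (\<forall>i\<in>S. mono (\<lambda>n. s (g n) i))"
  using assms
proof (induction S rule: finite_induct)
  case empty
  show ?case using strict_mono_id by auto
next
  case (insert x F)
  then obtain g :: "nat \<Rightarrow> nat" where g: "strict_mono g" "\<And>i. i \<in> F \<Longrightarrow> mono (\<lambda>n. s (g n) i)"
    by blast
  obtain h :: "nat \<Rightarrow> nat" where h: "strict_mono h" "mono ((\<lambda>n. s (g n) x) \<circ> h)"
    using nat_seq_mono_subseq by blast
  have "strict_mono (g \<circ> h)" using g h by (simp add: strict_mono_o)
  moreover have "mono (\<lambda>n. s ((g \<circ> h) n) i)" if "i \<in> insert x F" for i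
  proof (cases "i = x")
    case True
    then show ?thesis using h(2) by (simp add: comp_def)
  next
    case False
    then have "mono (\<lambda>n. s (g n) i)" using that g(2) by blast
    then show ?thesis using strict_mono_mono[OF h(1)] by (simp add: mono_def)
  qed
  ultimately show ?case by blast
qed

lemma dickson:
  fixes s :: "nat \<Rightarrow> 'i::finite \<Rightarrow> nat" and t :: "nat \<Rightarrow> nat"
  obtains i j where "i < j" "s i \<le> s j" "t i \<le> t j"
proof -
  \<comment> \<open>The extra coordinate \<open>t\<close> is adjoined at index \<open>None\<close>,
    so that the index type stays finite.\<close>
  let ?u = "\<lambda>n. case_option (t n) (s n)"
  obtain g :: "nat \<Rightarrow> nat" where g: "strict_mono g" "\<And>i. mono (\<lambda>n. ?u (g n) i)"
    using dickson_subseq[of UNIV ?u] by auto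
  have le: "?u (g 0) i \<le> ?u (g 1) i" for i using g(2)[of i] by (simp add: mono_def)
  have "g 0 < g 1" using g(1) by (simp add: strict_mono_def)
  moreover have "s (g 0) \<le> s (g 1)" using le[of "Some _"] by (simp add: le_fun_def)
  moreover have "t (g 0) \<le> t (g 1)" using le[of None] by simp
  ultimately show thesis by (rule that)
qed

section \<open>A monomial order\<close>

lemma mon_degree_add: "mon_degree (m + n) = mon_degree m + mon_degree n"
  by (simp add: mon_degree_def lookup_add sum.distrib)

text \<open>
  Assigning distinct primes to the variables, the value of a monomial at these primes is a
  monomial order with values in the natural numbers.
\<close>

lemma ex_monomial_order:
  obtains \<kappa> :: "'v::finite monomial \<Rightarrow> nat"
  where "inj \<kappa>" "\<And>m n k. \<kappa> m \<le> \<kappa> n \<Longrightarrow> \<kappa> (k + m) \<le> \<kappa> (k + n)"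
proof -
  obtain \<iota> :: "'v \<Rightarrow> nat" where \<iota>: "inj \<iota>"
    using finite_imp_inj_to_nat_seg[OF finite_class.finite_UNIV] by blast
  obtain \<pi> :: "nat \<Rightarrow> nat" where \<pi>: "inj \<pi>" "range \<pi> \<subseteq> {p. prime p}"
    using infinite_countable_subset[OF primes_infinite] by blast
  define q where "q = \<pi> \<circ> \<iota>"
  have q: "inj q" unfolding q_def using \<pi>(1) \<iota> by (rule inj_compose)
  have prime: "prime (q i)" for i using \<pi>(2) unfolding q_def by auto
  define \<kappa> where "\<kappa> m = (\<Prod>i\<in>UNIV. q i ^ Poly_Mapping.lookup m i)" for m
  have mult: "\<kappa> (m + n) = \<kappa> m * \<kappa> n" for m n
    by (simp add: \<kappa>_def lookup_add power_add prod.distrib)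
  \<comment> \<open>Unique factorization recovers the exponents from the value, which makes \<kappa>
    injective.\<close>
  have multiplicity: "multiplicity (q i) (\<kappa> m) = Poly_Mapping.lookup m i" for i m
  proof -
    have "\<kappa> m = (\<Prod>x\<in>range q. x ^ Poly_Mapping.lookup m (inv q x))"
      unfolding \<kappa>_def using q by (simp add: prod.reindex)
    then show ?thesis
      using multiplicity_prod_prime_powers[of "range q" "q i" "\<lambda>x. Poly_Mapping.lookup m (inv q x)"]
        prime q by auto
  qed
  show thesis
  proof
    show "inj \<kappa>" by (rule injI) (metis multiplicity poly_mapping_eqI)
  qed (simp add: mult)
qed

section \<open>Initial monomials of a tropical ideal\<close>

lemma lookup_single_times:
  fixes f :: "'v::finite monomial \<Rightarrow>\<^sub>0 'r::comm_semiring_1"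
  shows "Poly_Mapping.lookup (Poly_Mapping.single n 1 * f) (n + m) = Poly_Mapping.lookup f m"
proof -
  have "Poly_Mapping.lookup (Poly_Mapping.single n 1 * f) (n + m)
      = (\<Sum>l. (\<Sum>q. Poly_Mapping.lookup f q when n + m = l + q) when n = l)"
    unfolding lookup_mult lookup_single by (simp only: when_mult mult_1)
  also have "\<dots> = (\<Sum>q. Poly_Mapping.lookup f q when n + m = n + q)"
    by (simp only: when_def Sum_any.delta')
  also have "\<dots> = Poly_Mapping.lookup f m"
    by (simp only: when_def add_left_cancel Sum_any.delta')
  finally show ?thesis .
qed

lemma keys_single_times:
  fixes f :: "'v::finite monomial \<Rightarrow>\<^sub>0 'r::comm_semiring_1"
  shows "Poly_Mapping.keys (Poly_Mapping.single n 1 * f) \<subseteq> (+) n ` Poly_Mapping.keys f"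
  using keys_mult[of "Poly_Mapping.single n 1" f] by auto

text \<open>The bound \<open>d\<close> is a genuine parameter: \<kappa> need not refine the degree,
  so a polynomial may have a degree larger than that of its leading monomial.\<close>

abbreviation initial_part ::
  "('v::finite monomial \<Rightarrow> nat) \<Rightarrow> ('v, 'r::comm_semiring_1) polynomial set \<Rightarrow> nat \<Rightarrow> 'v monomial set" where
  "initial_part \<kappa> I d \<equiv> initial \<kappa> (Poly_Mapping.lookup ` degree_le_part I d)"

lemma initial_part_mono: "I \<subseteq> J \<Longrightarrow> initial_part \<kappa> I d \<subseteq> initial_part \<kappa> J d"
  unfolding degree_le_part_def by (intro initial_mono) blast

lemma initial_part_degree: "m \<in> initial_part \<kappa> I d \<Longrightarrow> mon_degree m \<le> d"
  by (auto simp: initial_def degree_le_part_def Mon_le_def in_keys_iff)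

text \<open>Multiplying a witness by the monomial \<open>n\<close> translates its support, preserves
  comparisons under \<kappa> and raises degrees by \<open>mon_degree n\<close>.\<close>

lemma initial_part_upward_closed:
  fixes I :: "('v::finite, 'r::comm_semiring_1) polynomial set"
  assumes I: "semiring_ideal I" and \<kappa>: "\<And>m n k. \<kappa> m \<le> \<kappa> n \<Longrightarrow> \<kappa> (k + m) \<le> \<kappa> (k + n)"
    and m: "m \<in> initial_part \<kappa> I d" and le: "mon_degree n + d \<le> d'"
  shows "n + m \<in> initial_part \<kappa> I d'"
proof -
  obtain f where f: "f \<in> I" "Poly_Mapping.keys f \<subseteq> Mon_le d"
    "Poly_Mapping.lookup f m \<noteq> 0" "\<And>x. Poly_Mapping.lookup f x \<noteq> 0 \<Longrightarrow> \<kappa> x \<le> \<kappa> m"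
    using m by (auto simp: initial_def degree_le_part_def)
  let ?g = "Poly_Mapping.single n 1 * f"
  have "?g \<in> I" using I f(1) unfolding semiring_ideal_def by blast
  moreover have "Poly_Mapping.keys ?g \<subseteq> Mon_le d'"
    using keys_single_times[of n f] f(2) le by (fastforce simp: Mon_le_def mon_degree_add)
  moreover have "Poly_Mapping.lookup ?g (n + m) \<noteq> 0" using f(3) by (simp add: lookup_single_times)
  moreover have "\<kappa> x \<le> \<kappa> (n + m)" if "Poly_Mapping.lookup ?g x \<noteq> 0" for x
  proof -
    have "x \<in> (+) n ` Poly_Mapping.keys f"
      using that keys_single_times[of n f] by (auto simp: in_keys_iff)
    then obtain y where y: "x = n + y" "Poly_Mapping.lookup f y \<noteq> 0"
      by (auto simp: in_keys_iff)
    show ?thesis unfolding y(1) by (rule \<kappa>[OF f(4)[OF y(2)]])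
  qed
  ultimately show ?thesis unfolding initial_def degree_le_part_def by blast
qed

text \<open>Equal sets of initial monomials have complements of equal size, so the ranks agree in
  every degree bound and the inclusion becomes an equality.\<close>

lemma tropical_ideal_eq:
  fixes I J :: "('v::finite, 'r::valuative_semifield) polynomial set"
  assumes I: "tropical_ideal I" and J: "tropical_ideal J" and sub: "I \<subseteq> J" and \<kappa>: "inj \<kappa>"
    and eq: "\<And>d. initial_part \<kappa> I d = initial_part \<kappa> J d"
  shows "I = J"
proof
  have part: "degree_le_part I d = degree_le_part J d" for d
  proof -
    obtain r p where M: "valuated_matroid (Mon_le d) r p"
      and Ip: "Poly_Mapping.lookup ` degree_le_part I d = vectors (Mon_le d) p"
      using I unfolding tropical_ideal_def by blast
    obtain s q where N: "valuated_matroid (Mon_le d) s q"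
      and Jq: "Poly_Mapping.lookup ` degree_le_part J d = vectors (Mon_le d) q"
      using J unfolding tropical_ideal_def by blast
    have "inj_on \<kappa> (Mon_le d)" using \<kappa> by (rule inj_on_subset) simp
    then have "r = s"
      using card_complement_initial[OF M] card_complement_initial[OF N] eq[of d] Ip Jq by metis
    moreover have "degree_le_part I d \<subseteq> degree_le_part J d"
      using sub unfolding degree_le_part_def by blast
    then have "vectors (Mon_le d) p \<subseteq> vectors (Mon_le d) q" using Ip Jq by (metis image_mono)
    ultimately have "vectors (Mon_le d) p = vectors (Mon_le d) q"
      using M N vectors_eq_of_subset_same_rank by blast
    then show ?thesis using Ip Jq inj_lookup by (metis inj_image_eq_iff)
  qed
  show "J \<subseteq> I"
  proof
    fix f assume "f \<in> J"
    \<comment> \<open>A crude degree bound, valid also for the zero polynomial.\<close>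
    let ?d = "\<Sum>m\<in>Poly_Mapping.keys f. mon_degree m"
    have "Poly_Mapping.keys f \<subseteq> Mon_le ?d"
      by (auto simp: Mon_le_def intro: member_le_sum)
    then have "f \<in> degree_le_part J ?d" using \<open>f \<in> J\<close> by (simp add: degree_le_part_def)
    then have "f \<in> degree_le_part I ?d" by (simp only: part)
    then show "f \<in> I" by (simp add: degree_le_part_def)
  qed
qed (rule sub)

text \<open>Each strict step \<open>k\<close> adds a new pair \<open>(d k, m k)\<close>. Dickson's
  lemma gives \<open>i < j\<close> with pair \<open>i\<close> below pair \<open>j\<close>; the
  former is present in \<open>I j\<close>, so upward closure puts the latter there before it is
  supposed to be new.\<close>

lemma no_ascending_chain:
  fixes I :: "nat \<Rightarrow> ('v::finite, 'r::valuative_semifield) polynomial set"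
  assumes trop: "\<And>k. tropical_ideal (I k)" and chain: "\<And>k. I k \<subset> I (Suc k)"
  shows False
proof -
  obtain \<kappa> :: "'v monomial \<Rightarrow> nat"
    where \<kappa>: "inj \<kappa>" "\<And>m n k. \<kappa> m \<le> \<kappa> n \<Longrightarrow> \<kappa> (k + m) \<le> \<kappa> (k + n)"
    using ex_monomial_order by blast
  have ideal: "semiring_ideal (I k)" for k using trop unfolding tropical_ideal_def by blast
  have mono: "I i \<subseteq> I j" if "i \<le> j" for i j
    using lift_Suc_mono_le[of I, OF _ that] chain by blast
  have "\<exists>d m. m \<in> initial_part \<kappa> (I (Suc k)) d - initial_part \<kappa> (I k) d" for k
  proof (rule ccontr)
    assume "\<not> ?thesis"
    then have "initial_part \<kappa> (I k) d = initial_part \<kappa> (I (Suc k)) d" for d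
      using initial_part_mono[of "I k" "I (Suc k)" \<kappa> d] chain[of k] by blast
    then show False using tropical_ideal_eq[OF trop trop _ \<kappa>(1)] chain[of k] by blast
  qed
  then obtain d m where new: "\<And>k. m k \<in> initial_part \<kappa> (I (Suc k)) (d k)"
    and old: "\<And>k. m k \<notin> initial_part \<kappa> (I k) (d k)"
    by (metis DiffD1 DiffD2)
  obtain i j where ij: "i < j" "Poly_Mapping.lookup (m i) \<le> Poly_Mapping.lookup (m j)"
    "d i - mon_degree (m i) \<le> d j - mon_degree (m j)"
    using dickson[of "\<lambda>k. Poly_Mapping.lookup (m k)" "\<lambda>k. d k - mon_degree (m k)"] by blast
  let ?n = "m j - m i"
  have n: "?n + m i = m j"
    using ij(2) by (intro poly_mapping_eqI) (simp add: lookup_add lookup_minus le_fun_def)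
  have "mon_degree ?n + mon_degree (m i) = mon_degree (m j)" by (metis mon_degree_add n)
  \<comment> \<open>Initial monomials obey the degree bound, so the natural subtractions in the
    Dickson coordinates are not truncated.\<close>
  then have le: "mon_degree ?n + d i \<le> d j"
    using ij(3) initial_part_degree[OF new[of i]] initial_part_degree[OF new[of j]] by linarith
  have "m i \<in> initial_part \<kappa> (I j) (d i)"
    using new[of i] initial_part_mono[OF mono[of "Suc i" j]] ij(1) by (auto simp: Suc_le_eq)
  from initial_part_upward_closed[OF ideal \<kappa>(2) this le]
  have "m j \<in> initial_part \<kappa> (I j) (d j)" by (simp add: n)
  then show False using old by blast
qed

theorem theorem3p11:
  shows "(\<forall>I J :: ('v::finite, 'r::valuative_semifield) polynomial set.
            homogeneous_tropical_ideal I \<and> homogeneous_tropical_ideal J \<and> I \<subseteq> J \<and>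
            (\<forall>d. hilbert_function I d = hilbert_function J d) \<longrightarrow> I = J) \<and>
         \<not> (\<exists>I :: nat \<Rightarrow> ('v, 'r) polynomial set.
               (\<forall>k. tropical_ideal (I k)) \<and> (\<forall>k. I k \<subset> I (Suc k)))"
proof (intro conjI allI impI notI)
  fix I J :: "('v, 'r) polynomial set"
  assume "homogeneous_tropical_ideal I \<and> homogeneous_tropical_ideal J \<and> I \<subseteq> J \<and>
    (\<forall>d. hilbert_function I d = hilbert_function J d)"
  then show "I = J" by (intro homogeneous_tropical_ideal_eq) simp_all
next
  assume "\<exists>I :: nat \<Rightarrow> ('v, 'r) polynomial set.
    (\<forall>k. tropical_ideal (I k)) \<and> (\<forall>k. I k \<subset> I (Suc k))"
  then obtain I :: "nat \<Rightarrow> ('v, 'r) polynomial set"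
    where "\<And>k. tropical_ideal (I k)" "\<And>k. I k \<subset> I (Suc k)" by blast
  then show False by (rule no_ascending_chain)
qed

end
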